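(* In the setting described in the context, let $U_0,\dots,U_d$ be one of the six decompositions below, with $U_{-1}=U_{d+1}=0$. Then for $0\le i\le d$: $[0D]$: $(B-bq^{d-2i}I)U_i\subseteq U_{i-1}$ and $(B^*-b^*q^{d-2i}I)U_i\subseteq U_{i+1}$; $[0^*D^*]$: $(B-bq^{2i-d}I)U_i\subseteq U_{i-1}$ and $(B^*-b^*q^{2i-d}I)U_i\subseteq U_{i+1}$; $[0^*D]$: $(B-bq^{2i-d}I)U_i\subseteq U_{i-1}$ and $(B^*-b^*q^{d-2i}I)U_i\subseteq U_{i+1}$; $[0^*0]$: $(B-bq^{2i-d}I)U_i=0$ and $B^*U_i\subseteq U_{i-1}+U_i+U_{i+1}$; $[D^*0]$: $(B-bq^{2i-d}I)U_i\subseteq U_{i+1}$ and $(B^*-b^*q^{d-2i}I)U_i\subseteq U_{i-1}$; $[D^*D]$: $BU_i\subseteq U_{i-1}+U_i+U_{i+1}$ and $(B^*-b^*q^{d-2i}I)U_i=0$.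
   Context: $\mathbb K$ is an algebraically closed field, $q\in\mathbb K$ nonzero and not a root of unity, $V$ a nonzero finite-dimensional $\mathbb K$-vector space. A tridiagonal pair on $V$ is an ordered pair $A,A^*$ of linear maps $V\to V$ such that: (i) each of $A,A^*$ is diagonalizable; (ii) there is an ordering $V_0,\dots,V_d$ of the eigenspaces of $A$ with $A^*V_i\subseteq V_{i-1}+V_i+V_{i+1}$ ($V_{-1}=V_{d+1}=0$); (iii) there is an ordering $V^*_0,\dots,V^*_\delta$ of the eigenspaces of $A^*$ with $AV^*_i\subseteq V^*_{i-1}+V^*_i+V^*_{i+1}$ ($V^*_{-1}=V^*_{\delta+1}=0$); (iv) no subspace $W\ne0,V$ satisfies $AW\subseteq W$, $A^*W\subseteq W$. It is known $d=\delta$; orderings as in (ii),(iii) are called standard. Setting: $A,A^*$ is a tridiagonal pair on $V$; $V_0,\dots,V_d$ (resp. $V^*_0,\dots,V^*_d$) is a standard ordering of the eigenspaces of $A$ (resp. $A^*$); the eigenvalue of $A$ on $V_i$ is $aq^{2i-d}$ and that of $A^*$ on $V^*_i$ is $a^*q^{d-2i}$ for some nonzero $a,a^*\in\mathbb K$; $b,b^*\in\mathbb K$ are nonzero. The six decompositions of $V$ (sequences of nonzero subspaces whose sum is direct and equals $V$) are, for $0\le i\le d$: $[0D]$: $U_i=V_i$; $[0^*D^*]$: $U_i=V^*_i$; $[0^*D]$: $U_i=(V^*_0+\cdots+V^*_i)\cap(V_i+\cdots+V_d)$; $[0^*0]$: $U_i=(V^*_0+\cdots+V^*_i)\cap(V_0+\cdots+V_{d-i})$;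 $[D^*0]$: $U_i=(V^*_{d-i}+\cdots+V^*_d)\cap(V_0+\cdots+V_{d-i})$; $[D^*D]$: $U_i=(V^*_{d-i}+\cdots+V^*_d)\cap(V_i+\cdots+V_d)$. $B:V\to V$ is the linear map acting as $bq^{2i-d}I$ on the $i$th subspace of $[0^*0]$ for each $i$, and $B^*:V\to V$ is the linear map acting as $b^*q^{d-2i}I$ on the $i$th subspace of $[D^*D]$ for each $i$. *)

theory Defs
  imports Main "HOL-Computational_Algebra.Polynomial"
begin

text \<open>Algebraically closed field: every nonconstant polynomial has a root.\<close>
definition alg_closed :: "'k::field itself \<Rightarrow> bool" where
  "alg_closed _ \<longleftrightarrow> (\<forall>p :: 'k poly. 0 < degree p \<longrightarrow> (\<exists>x. poly p x = 0))"

definition not_root_of_unity :: "'k::field \<Rightarrow> bool" where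
  "not_root_of_unity q \<longleftrightarrow> (\<forall>n::nat. 0 < n \<longrightarrow> q ^ n \<noteq> 1)"

text \<open>Eigenspace of a map A for a scalar th (the space V is the whole type 'v).\<close>
definition eigsp :: "('k \<Rightarrow> 'v \<Rightarrow> 'v) \<Rightarrow> ('v \<Rightarrow> 'v) \<Rightarrow> 'k \<Rightarrow> 'v set" where
  "eigsp scale A th = {v. A v = scale th v}"

text \<open>Sum of a family of subspaces over an index set.\<close>
definition ssum :: "('i \<Rightarrow> 'v::comm_monoid_add set) \<Rightarrow> 'i set \<Rightarrow> 'v set" where
  "ssum U I = {(\<Sum>i\<in>I. f i) | f. \<forall>i\<in>I. f i \<in> U i}"

text \<open>Extension of a sequence of subspaces U_0..U_d by U_j = 0 for j outside [0,d].\<close>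
definition ext :: "nat \<Rightarrow> (nat \<Rightarrow> 'v::zero set) \<Rightarrow> int \<Rightarrow> 'v set" where
  "ext d U j = (if 0 \<le> j \<and> j \<le> int d then U (nat j) else {0})"

definition diagonalizable :: "('k::field \<Rightarrow> 'v::ab_group_add \<Rightarrow> 'v) \<Rightarrow> ('v \<Rightarrow> 'v) \<Rightarrow> bool" where
  "diagonalizable scale A \<longleftrightarrow> module.span scale (\<Union>th. eigsp scale A th) = UNIV"

text \<open>th_0..th_d is an ordering of the eigenvalues of A (so eigsp A (th i), i=0..d, is an
  ordering of the eigenspaces of A), and it is standard with respect to As.\<close>
definition standard_ordering ::
  "('k::field \<Rightarrow> 'v::ab_group_add \<Rightarrow> 'v) \<Rightarrow> ('v \<Rightarrow> 'v) \<Rightarrow> ('v \<Rightarrow> 'v) \<Rightarrow> nat \<Rightarrow> (nat \<Rightarrow> 'k) \<Rightarrow> bool" where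
  "standard_ordering scale A As d th \<longleftrightarrow>
     inj_on th {..d} \<and>
     (\<forall>i\<le>d. eigsp scale A (th i) \<noteq> {0}) \<and>
     (\<forall>mu. eigsp scale A mu \<noteq> {0} \<longrightarrow> mu \<in> th ` {..d}) \<and>
     (\<forall>i\<le>d. As ` eigsp scale A (th i) \<subseteq>
        ssum (ext d (\<lambda>j. eigsp scale A (th j))) {int i - 1 .. int i + 1})"

definition tridiagonal_pair :: "('k::field \<Rightarrow> 'v::ab_group_add \<Rightarrow> 'v) \<Rightarrow> ('v \<Rightarrow> 'v) \<Rightarrow> ('v \<Rightarrow> 'v) \<Rightarrow> bool" where
  "tridiagonal_pair scale A As \<longleftrightarrow>
     Vector_Spaces.linear scale scale A \<and> Vector_Spaces.linear scale scale As \<and>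
     diagonalizable scale A \<and> diagonalizable scale As \<and>
     (\<exists>d th. standard_ordering scale A As d th) \<and>
     (\<exists>delta th. standard_ordering scale As A delta th) \<and>
     (\<forall>W. module.subspace scale W \<and> A ` W \<subseteq> W \<and> As ` W \<subseteq> W \<longrightarrow> W = {0} \<or> W = UNIV)"

text \<open>The six decompositions, given V_0..V_d (V) and V*_0..V*_d (Vs).\<close>
definition dec_0D :: "nat \<Rightarrow> (nat \<Rightarrow> 'v::comm_monoid_add set) \<Rightarrow> (nat \<Rightarrow> 'v set) \<Rightarrow> nat \<Rightarrow> 'v set" where
  "dec_0D d V Vs i = V i"
definition dec_0sDs :: "nat \<Rightarrow> (nat \<Rightarrow> 'v::comm_monoid_add set) \<Rightarrow> (nat \<Rightarrow> 'v set) \<Rightarrow> nat \<Rightarrow> 'v set" where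
  "dec_0sDs d V Vs i = Vs i"
definition dec_0sD :: "nat \<Rightarrow> (nat \<Rightarrow> 'v::comm_monoid_add set) \<Rightarrow> (nat \<Rightarrow> 'v set) \<Rightarrow> nat \<Rightarrow> 'v set" where
  "dec_0sD d V Vs i = ssum Vs {0..i} \<inter> ssum V {i..d}"
definition dec_0s0 :: "nat \<Rightarrow> (nat \<Rightarrow> 'v::comm_monoid_add set) \<Rightarrow> (nat \<Rightarrow> 'v set) \<Rightarrow> nat \<Rightarrow> 'v set" where
  "dec_0s0 d V Vs i = ssum Vs {0..i} \<inter> ssum V {0..d-i}"
definition dec_Ds0 :: "nat \<Rightarrow> (nat \<Rightarrow> 'v::comm_monoid_add set) \<Rightarrow> (nat \<Rightarrow> 'v set) \<Rightarrow> nat \<Rightarrow> 'v set" where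
  "dec_Ds0 d V Vs i = ssum Vs {d-i..d} \<inter> ssum V {0..d-i}"
definition dec_DsD :: "nat \<Rightarrow> (nat \<Rightarrow> 'v::comm_monoid_add set) \<Rightarrow> (nat \<Rightarrow> 'v set) \<Rightarrow> nat \<Rightarrow> 'v set" where
  "dec_DsD d V Vs i = ssum Vs {d-i..d} \<inter> ssum V {i..d}"

text \<open>(M - c I) applied to a set.\<close>
definition shifted_image :: "('k::field \<Rightarrow> 'v::ab_group_add \<Rightarrow> 'v) \<Rightarrow> ('v \<Rightarrow> 'v) \<Rightarrow> 'k \<Rightarrow> 'v set \<Rightarrow> 'v set" where
  "shifted_image scale M c U = (\<lambda>u. M u - scale c u) ` U"

end

theory Submission
  imports Defs
begin

(* On the split decomposition [0*0], U_0, ..., U_d, the map A - a q^(d-2i) raises U_i into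
   U_(i+1), A* - a* q^(2i-d) lowers it into U_(i-1), and B acts as b q^(2i-d).  Comparing
   both sides on each U_i yields the q-Weyl relations q A B - q^-1 B A = (q - q^-1) a b I and
   q^-1 A* B - q B A* = (q^-1 - q) a* b I; the split decomposition [D*D] gives the two
   relations for B*.  Such a relation shifts eigenvectors: if A v = theta v and
   theta beta = a b, then B v - beta v is an eigenvector of A for theta q^-2.  So
   B - b q^(d-2j) maps V_j into V_(j-1), and in the same way B and B* move every V_j and V*_j
   one step.  The six statements follow by intersecting the flags V_0 + ... + V_i,
   V_i + ... + V_d and their starred versions.  For [0*0] and [D*D] one also needs
   (V*_0 + ... + V*_k) meet (V_0 + ... + V_(d-k-1)) = 0, which holds by irreducibility: the
   span of these meets is invariant under A and A* but misses V_d. *)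

lemma power_int_inj:
  fixes q :: "'k::field"
  assumes "q \<noteq> 0" "not_root_of_unity q" "q powi m = q powi n"
  shows "m = n"
proof (rule ccontr)
  have no_gap: False if "k < l" "q powi k = q powi l" for k l :: int
  proof -
    have "q powi l = q powi k * q powi (l - k)"
      using assms(1) by (simp flip: power_int_add)
    also have "q powi (l - k) = q ^ nat (l - k)"
      using \<open>k < l\<close> by (simp add: power_int_nonneg_exp)
    finally have "q powi l = q powi k * q ^ nat (l - k)" .
    then have "q ^ nat (l - k) = 1"
      using that(2) assms(1) by simp
    then show False
      using \<open>k < l\<close> assms(2) by (simp add: not_root_of_unity_def)
  qed
  assume "m \<noteq> n"
  then show False
    using no_gap assms(3) by (metis linorder_neq_iff)
qed

lemma image_diff_atMost:
  assumes "k \<le> d"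
  shows "(\<lambda>j. d - j) ` {..k} = {d - k..(d::nat)}"
proof
  show "{d - k..d} \<subseteq> (\<lambda>j. d - j) ` {..k}"
  proof
    fix n assume "n \<in> {d - k..d}"
    then show "n \<in> (\<lambda>j. d - j) ` {..k}"
      using assms by (intro image_eqI[of _ _ "d - n"]) auto
  qed
qed auto

lemma ext_cong: "(\<And>j. j \<le> d \<Longrightarrow> U j = W j) \<Longrightarrow> ext d U = ext d W"
  by (auto simp: fun_eq_iff ext_def)

lemma ext_in_range: "0 \<le> k \<and> k \<le> int d \<Longrightarrow> ext d U k = U (nat k)"
  and ext_out_of_range: "\<not> (0 \<le> k \<and> k \<le> int d) \<Longrightarrow> ext d U k = {0}"
  unfolding ext_def by auto

lemma ext_reverse: "ext d (\<lambda>j. U (d - j)) = (\<lambda>k. ext d U (int d - k))"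
  by (auto simp: fun_eq_iff ext_def nat_diff_distrib)

lemma ext_minus_one: "ext d U (int i - 1) = (if 0 < i \<and> i \<le> Suc d then U (i - 1) else {0})"
  by (auto simp: ext_def nat_diff_distrib)

lemma ext_plus_one: "ext d U (int i + 1) = (if i < d then U (Suc i) else {0})"
  by (auto simp: ext_def nat_add_distrib)

lemma ssum_reindex:
  assumes "inj_on g I"
  shows "ssum (\<lambda>i. U (g i)) I = ssum U (g ` I)"
proof
  show "ssum (\<lambda>i. U (g i)) I \<subseteq> ssum U (g ` I)"
  proof
    fix x assume "x \<in> ssum (\<lambda>i. U (g i)) I"
    then obtain f where x: "x = sum f I" and f: "\<forall>i\<in>I. f i \<in> U (g i)"
      by (auto simp: ssum_def)
    let ?f = "\<lambda>j. f (the_inv_into I g j)"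
    have "sum ?f (g ` I) = x"
      using assms by (simp add: x sum.reindex the_inv_into_f_f)
    moreover have "\<forall>j\<in>g ` I. ?f j \<in> U j"
      using assms f by (auto simp: the_inv_into_f_f)
    ultimately show "x \<in> ssum U (g ` I)"
      unfolding ssum_def by blast
  qed
  show "ssum U (g ` I) \<subseteq> ssum (\<lambda>i. U (g i)) I"
    using assms by (auto simp: ssum_def sum.reindex)
qed

lemma standard_ordering_reverse:
  assumes "standard_ordering scale A As d th"
  shows "standard_ordering scale A As d (\<lambda>j. th (d - j))"
proof -
  define W where "W = (\<lambda>j. eigsp scale A (th j))"
  have tridiagonal: "As ` W j \<subseteq> ssum (ext d W) {int j - 1..int j + 1}" if "j \<le> d" for j
    using assms that by (simp add: standard_ordering_def W_def)
  have "As ` W (d - i) \<subseteq> ssum (ext d (\<lambda>j. W (d - j))) {int i - 1..int i + 1}"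
    if "i \<le> d" for i
  proof -
    have "ssum (ext d (\<lambda>j. W (d - j))) {int i - 1..int i + 1}
        = ssum (\<lambda>k. ext d W (int d - k)) {int i - 1..int i + 1}"
      by (simp only: ext_reverse)
    also have "\<dots> = ssum (ext d W) {int (d - i) - 1..int (d - i) + 1}"
      using ssum_reindex[of "\<lambda>k. int d - k" _ "ext d W"]
      by (simp add: inj_on_def of_nat_diff that algebra_simps)
    finally show ?thesis
      using tridiagonal[of "d - i"] by simp
  qed
  moreover have "inj_on (\<lambda>j. th (d - j)) {..d}"
  proof (rule inj_onI)
    fix x y assume "x \<in> {..d}" "y \<in> {..d}" "th (d - x) = th (d - y)"
    moreover have "inj_on th {..d}"
      using assms by (simp add: standard_ordering_def)
    ultimately have "d - x = d - y"
      by (auto dest: inj_onD)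
    then show "x = y"
      using \<open>x \<in> {..d}\<close> \<open>y \<in> {..d}\<close> by simp
  qed
  moreover have "mu \<in> (\<lambda>j. th (d - j)) ` {..d}" if "mu \<in> th ` {..d}" for mu
  proof -
    obtain k where "k \<le> d" "mu = th (d - (d - k))"
      using \<open>mu \<in> th ` {..d}\<close> by auto
    then show ?thesis
      by (intro image_eqI[of _ _ "d - k"]) auto
  qed
  ultimately show ?thesis
    using assms by (auto simp: standard_ordering_def W_def)
qed

sublocale vector_space \<subseteq> endo: vector_space_pair scale scale ..

definition q_weyl_rel ::
  "('a::field \<Rightarrow> 'b::ab_group_add \<Rightarrow> 'b) \<Rightarrow> 'a \<Rightarrow> ('b \<Rightarrow> 'b) \<Rightarrow> ('b \<Rightarrow> 'b) \<Rightarrow> 'a \<Rightarrow> bool" where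
  "q_weyl_rel scale q M N c \<longleftrightarrow>
     (\<forall>v. scale q (M (N v)) - scale (inverse q) (N (M v)) = scale ((q - inverse q) * c) v)"

context vector_space
begin

lemma linear_shift:
  "Vector_Spaces.linear (*s) (*s) f \<Longrightarrow> Vector_Spaces.linear (*s) (*s) (\<lambda>x. f x - c *s x)"
  by (simp add: endo.linear_compose_sub)

lemma subspace_eigsp: "Vector_Spaces.linear (*s) (*s) f \<Longrightarrow> subspace (eigsp (*s) f c)"
  using endo.linear_subspace_kernel[OF linear_shift, of f c] by (simp add: eigsp_def)

lemma ssum_eq_span:
  assumes "finite I" and subspaces: "\<And>i. i \<in> I \<Longrightarrow> subspace (U i)"
  shows "ssum U I = span (\<Union>(U ` I))"
proof
  show "ssum U I \<subseteq> span (\<Union>(U ` I))"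
    unfolding ssum_def by (blast intro: span_sum span_base)
  have "subspace (ssum U I)"
  proof (rule subspaceI)
    show "0 \<in> ssum U I"
      unfolding ssum_def by (auto intro!: exI[of _ "\<lambda>_. 0"] subspace_0 subspaces)
  next
    fix x y assume "x \<in> ssum U I" "y \<in> ssum U I"
    then obtain f g where "x = sum f I" "\<forall>i\<in>I. f i \<in> U i" "y = sum g I" "\<forall>i\<in>I. g i \<in> U i"
      unfolding ssum_def by auto
    then show "x + y \<in> ssum U I"
      unfolding ssum_def
      by (auto intro!: exI[of _ "\<lambda>i. f i + g i"] subspace_add subspaces simp: sum.distrib)
  next
    fix c x assume "x \<in> ssum U I"
    then obtain f where "x = sum f I" "\<forall>i\<in>I. f i \<in> U i"
      unfolding ssum_def by auto
    then show "c *s x \<in> ssum U I"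
      unfolding ssum_def
      by (auto intro!: exI[of _ "\<lambda>i. c *s f i"] subspace_scale subspaces simp: scale_sum_right)
  qed
  moreover have "\<Union>(U ` I) \<subseteq> ssum U I"
  proof
    fix x assume "x \<in> \<Union>(U ` I)"
    then obtain i where "i \<in> I" "x \<in> U i" by blast
    then have "x = (\<Sum>j\<in>I. if j = i then x else 0)" "\<forall>j\<in>I. (if j = i then x else 0) \<in> U j"
      using \<open>finite I\<close> by (auto intro: subspace_0 subspaces)
    then show "x \<in> ssum U I"
      unfolding ssum_def by blast
  qed
  ultimately show "span (\<Union>(U ` I)) \<subseteq> ssum U I"
    by (intro span_minimal)
qed

lemma ext_subset_span:
  assumes "0 \<le> k \<and> k \<le> int d \<Longrightarrow> nat k \<in> J"
  shows "ext d W k \<subseteq> span (\<Union>(W ` J))"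
  using assms by (auto simp: ext_def intro: span_base span_zero)

lemma ssum_ext_adjacent:
  assumes "\<And>j. j \<le> d \<Longrightarrow> subspace (U j)"
  shows "ssum (ext d U) {int i - 1..int i + 1} = span (\<Union>(U ` ({i - 1..i + 1} \<inter> {..d})))"
proof -
  have "ssum (ext d U) {int i - 1..int i + 1} = span (\<Union>(ext d U ` {int i - 1..int i + 1}))"
    using assms by (intro ssum_eq_span) (auto simp: ext_def)
  also have "\<dots> = span (\<Union>(U ` ({i - 1..i + 1} \<inter> {..d})))"
  proof (rule span_eq[THEN iffD2], intro conjI subsetI)
    fix x assume "x \<in> \<Union>(ext d U ` {int i - 1..int i + 1})"
    then obtain k where "k \<in> {int i - 1..int i + 1}" "x \<in> ext d U k" by blast
    then show "x \<in> span (\<Union>(U ` ({i - 1..i + 1} \<inter> {..d})))"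
      using ext_subset_span[of k d "{i - 1..i + 1} \<inter> {..d}" U] by force
  next
    fix x assume "x \<in> \<Union>(U ` ({i - 1..i + 1} \<inter> {..d}))"
    then obtain n where "n \<in> {i - 1..i + 1}" "n \<le> d" "x \<in> U n" by blast
    then have "x \<in> ext d U (int n)" "int n \<in> {int i - 1..int i + 1}"
      by (auto simp: ext_def)
    then show "x \<in> span (\<Union>(ext d U ` {int i - 1..int i + 1}))"
      by (blast intro: span_base)
  qed
  finally show ?thesis .
qed

lemma span_image_subset:
  assumes "Vector_Spaces.linear (*s) (*s) f" "\<And>x. x \<in> S \<Longrightarrow> f x \<in> T" "subspace T"
    and "u \<in> span S"
  shows "f u \<in> T"
proof -
  have "f u \<in> span (f ` S)"
    using assms(1,4) by (simp add: endo.linear_span_image)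
  moreover have "span (f ` S) \<subseteq> T"
    using assms(2,3) span_minimal[of "f ` S" T] by blast
  ultimately show ?thesis by blast
qed

lemma span_shift:
  assumes f: "Vector_Spaces.linear (*s) (*s) f"
    and shift: "\<And>j y. j \<in> I \<Longrightarrow> y \<in> W j \<Longrightarrow> f y - c j *s y \<in> span (\<Union>(W ` J))"
    and index: "\<And>j. j \<in> I \<Longrightarrow> c j = c' \<or> j \<in> J"
    and u: "u \<in> span (\<Union>(W ` I))"
  shows "f u - c' *s u \<in> span (\<Union>(W ` J))"
proof (rule span_image_subset[OF linear_shift[OF f] _ subspace_span u])
  fix y assume "y \<in> \<Union>(W ` I)"
  then obtain j where j: "j \<in> I" "y \<in> W j" by blast
  have "f y - c' *s y = (f y - c j *s y) + (c j - c') *s y"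
    by (simp add: algebra_simps)
  also have "\<dots> \<in> span (\<Union>(W ` J))"
    by (rule span_add[OF shift[OF j]])
      (use index[OF j(1)] j in \<open>auto intro: span_scale span_base span_zero\<close>)
  finally show "f y - c' *s y \<in> span (\<Union>(W ` J))" .
qed

lemma lowering_lower_flag:
  assumes f: "Vector_Spaces.linear (*s) (*s) f"
    and lowers: "\<And>j y. j \<le> d \<Longrightarrow> y \<in> W j \<Longrightarrow> f y - c j *s y \<in> ext d W (int j - 1)"
    and "i \<le> d" "u \<in> span (\<Union>(W ` {..i}))"
  shows "f u - c i *s u \<in> span (\<Union>(W ` {..<i}))"
proof (rule span_shift[OF f _ _ assms(4)])
  fix j y assume "j \<in> {..i}" "y \<in> W j"
  then show "f y - c j *s y \<in> span (\<Union>(W ` {..<i}))"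
    using lowers[of j y] \<open>i \<le> d\<close> ext_subset_span[of "int j - 1" d "{..<i}" W] by force
qed auto

lemma lowering_upper_flag:
  assumes f: "Vector_Spaces.linear (*s) (*s) f"
    and lowers: "\<And>j y. j \<le> d \<Longrightarrow> y \<in> W j \<Longrightarrow> f y - c j *s y \<in> ext d W (int j - 1)"
    and "u \<in> span (\<Union>(W ` {i..d}))"
  shows "f u - c' *s u \<in> span (\<Union>(W ` {i - 1..d}))"
proof (rule span_shift[OF f _ _ assms(3)])
  fix j y assume "j \<in> {i..d}" "y \<in> W j"
  then show "f y - c j *s y \<in> span (\<Union>(W ` {i - 1..d}))"
    using lowers[of j y] ext_subset_span[of "int j - 1" d "{i - 1..d}" W] by force
qed auto

lemma raising_lower_flag:
  assumes f: "Vector_Spaces.linear (*s) (*s) f"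
    and raises: "\<And>j y. j \<le> d \<Longrightarrow> y \<in> W j \<Longrightarrow> f y - c j *s y \<in> ext d W (int j + 1)"
    and "i \<le> d" "u \<in> span (\<Union>(W ` {..i}))"
  shows "f u - c' *s u \<in> span (\<Union>(W ` {..min (Suc i) d}))"
proof (rule span_shift[OF f _ _ assms(4)])
  fix j y assume "j \<in> {..i}" "y \<in> W j"
  then show "f y - c j *s y \<in> span (\<Union>(W ` {..min (Suc i) d}))"
    using raises[of j y] \<open>i \<le> d\<close> ext_subset_span[of "int j + 1" d "{..min (Suc i) d}" W] by force
qed (use \<open>i \<le> d\<close> in auto)

lemma raising_upper_flag:
  assumes f: "Vector_Spaces.linear (*s) (*s) f"
    and raises: "\<And>j y. j \<le> d \<Longrightarrow> y \<in> W j \<Longrightarrow> f y - c j *s y \<in> ext d W (int j + 1)"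
    and "u \<in> span (\<Union>(W ` {i..d}))"
  shows "f u - c i *s u \<in> span (\<Union>(W ` {Suc i..d}))"
proof (rule span_shift[OF f _ _ assms(3)])
  fix j y assume "j \<in> {i..d}" "y \<in> W j"
  then show "f y - c j *s y \<in> span (\<Union>(W ` {Suc i..d}))"
    using raises[of j y] ext_subset_span[of "int j + 1" d "{Suc i..d}" W] by force
qed (auto simp: not_less_eq_eq dest: antisym)

lemma eigenvector_in_span_other_eigsp:
  assumes f: "Vector_Spaces.linear (*s) (*s) f" and "finite S" "mu \<notin> c ` S"
    and "f z = mu *s z" "z \<in> span (\<Union>j\<in>S. eigsp (*s) f (c j))"
  shows "z = 0"
  using assms(2-)
proof (induction S arbitrary: z rule: finite_induct)
  case (insert s S)
  let ?E = "\<lambda>j. eigsp (*s) f (c j)"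
  have "z \<in> span (?E s \<union> \<Union>(?E ` S))"
    using insert.prems(3) by simp
  moreover have "span (?E s) = ?E s"
    using subspace_eigsp[OF f] by simp
  ultimately obtain x w where z: "z = x + w" and x: "x \<in> ?E s" and w: "w \<in> span (\<Union>(?E ` S))"
    by (auto simp: span_Un)
  have "f w - c s *s w \<in> span (\<Union>(?E ` S))"
    by (rule span_shift[where c = c, OF f _ _ w]) (auto simp: eigsp_def span_zero)
  moreover have "f z - c s *s z = f w - c s *s w"
    using x by (simp add: z eigsp_def endo.linear_add[OF f] algebra_simps)
  moreover have "f z - c s *s z = (mu - c s) *s z"
    using insert.prems(2) by (simp add: algebra_simps)
  ultimately have "(mu - c s) *s z \<in> span (\<Union>(?E ` S))" by simp
  moreover have "f ((mu - c s) *s z) = mu *s ((mu - c s) *s z)"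
    using insert.prems(2) by (simp add: endo.linear_scale[OF f] scale_left_commute)
  ultimately have "(mu - c s) *s z = 0"
    using insert.IH insert.prems(1) by blast
  then show ?case
    using insert.prems(1) by simp
qed simp

lemma q_commutator_raising:
  assumes M: "Vector_Spaces.linear (*s) (*s) M" and N: "Vector_Spaces.linear (*s) (*s) N"
    and "q \<noteq> 0" "N u = \<beta> *s u" "N (M u - \<alpha> *s u) = (q\<^sup>2 * \<beta>) *s (M u - \<alpha> *s u)"
  shows "q *s M (N u) - inverse q *s N (M u) = ((q - inverse q) * (\<alpha> * \<beta>)) *s u"
proof -
  define r where "r = M u - \<alpha> *s u"
  have "M u = \<alpha> *s u + r"
    by (simp add: r_def)
  then have "q *s M (N u) - inverse q *s N (M u)
      = (q * \<beta> * \<alpha> - inverse q * \<alpha> * \<beta>) *s u + (q * \<beta> - inverse q * q\<^sup>2 * \<beta>) *s r"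
    using assms(4,5) by (simp add: r_def[symmetric] endo.linear_scale[OF M] endo.linear_add[OF N]
        endo.linear_scale[OF N] algebra_simps)
  also have "q * \<beta> - inverse q * q\<^sup>2 * \<beta> = 0"
    using \<open>q \<noteq> 0\<close> by (simp add: power2_eq_square)
  finally show ?thesis
    by (simp add: algebra_simps)
qed

lemma q_weyl_relI:
  assumes M: "Vector_Spaces.linear (*s) (*s) M" and N: "Vector_Spaces.linear (*s) (*s) N"
    and "q \<noteq> 0" and spanning: "span (\<Union>(U ` I)) = UNIV"
    and N_U: "\<And>i u. i \<in> I \<Longrightarrow> u \<in> U i \<Longrightarrow> N u = \<beta> i *s u"
    and raising: "\<And>i u. i \<in> I \<Longrightarrow> u \<in> U i \<Longrightarrow>
      N (M u - \<alpha> i *s u) = (q\<^sup>2 * \<beta> i) *s (M u - \<alpha> i *s u)"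
    and "\<And>i. i \<in> I \<Longrightarrow> \<alpha> i * \<beta> i = c"
  shows "q_weyl_rel (*s) q M N c"
proof -
  let ?D = "\<lambda>v. q *s M (N v) - inverse q *s N (M v) - ((q - inverse q) * c) *s v"
  have "Vector_Spaces.linear (*s) (*s) (\<lambda>v. M (N v))" "Vector_Spaces.linear (*s) (*s) (\<lambda>v. N (M v))"
    using Vector_Spaces.linear_compose[OF N M] Vector_Spaces.linear_compose[OF M N]
    by (simp_all add: o_def)
  then have "Vector_Spaces.linear (*s) (*s) ?D"
    by (intro linear_shift endo.linear_compose_sub endo.linear_compose_scale_right)
  then have "subspace {v. ?D v = 0}"
    by (rule endo.linear_subspace_kernel)
  moreover have "\<Union>(U ` I) \<subseteq> {v. ?D v = 0}"
    using q_commutator_raising[OF M N \<open>q \<noteq> 0\<close> N_U raising] assms(7) by auto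
  ultimately have "span (\<Union>(U ` I)) \<subseteq> {v. ?D v = 0}"
    by (intro span_minimal)
  then show ?thesis
    using spanning by (auto simp: q_weyl_rel_def)
qed

lemma q_weyl_rel_eigenvector:
  assumes M: "Vector_Spaces.linear (*s) (*s) M" and N: "Vector_Spaces.linear (*s) (*s) N"
    and "q \<noteq> 0" "q_weyl_rel (*s) q M N (\<theta> * \<beta>)" "M y = \<theta> *s y"
  shows "M (N y - \<beta> *s y) = (\<theta> / q\<^sup>2) *s (N y - \<beta> *s y)"
proof -
  have h: "q *s M (N y) = (inverse q * \<theta>) *s N y + ((q - inverse q) * (\<theta> * \<beta>)) *s y"
    using assms(4,5) by (simp add: q_weyl_rel_def endo.linear_scale[OF N] algebra_simps)
  have "M (N y - \<beta> *s y) = inverse q *s (q *s M (N y)) - (\<beta> * \<theta>) *s y"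
    using assms(3,5) by (simp add: endo.linear_diff[OF M] endo.linear_scale[OF M])
  also have "\<dots> = (inverse q * inverse q * \<theta>) *s N y
      + (inverse q * (q - inverse q) * (\<theta> * \<beta>) - \<beta> * \<theta>) *s y"
    unfolding h by (simp add: scale_right_distrib algebra_simps)
  also have "inverse q * (q - inverse q) * (\<theta> * \<beta>) - \<beta> * \<theta> = - (inverse q * inverse q * \<theta> * \<beta>)"
    using assms(3) by (simp add: field_simps)
  also have "inverse q * inverse q * \<theta> = \<theta> / q\<^sup>2"
    by (simp add: power2_eq_square field_simps)
  finally show ?thesis
    by (simp add: algebra_simps)
qed

end

section \<open>Flags and split decompositions of a tridiagonal pair\<close>

locale standard_td_pair = vector_space +
  fixes A As :: "'b \<Rightarrow> 'b" and d :: nat and th ths :: "nat \<Rightarrow> 'a"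
  assumes td_pair: "tridiagonal_pair scale A As"
    and standard_A: "standard_ordering scale A As d th"
    and standard_As: "standard_ordering scale As A d ths"
begin

definition V :: "nat \<Rightarrow> 'b set" where "V j = eigsp (*s) A (th j)"
definition Vs :: "nat \<Rightarrow> 'b set" where "Vs j = eigsp (*s) As (ths j)"

definition V_flag :: "nat \<Rightarrow> 'b set" where "V_flag j = span (\<Union>(V ` {..j}))"
definition Vs_flag :: "nat \<Rightarrow> 'b set" where "Vs_flag i = span (\<Union>(Vs ` {..i}))"

text \<open>\<open>flag_meet d\<close> is the split decomposition [0*0]; \<open>flag_meet (d - 1)\<close> turns out to be
  trivial, which is what lets the flags split along \<open>flag_meet d\<close>.\<close>

definition flag_meet :: "nat \<Rightarrow> nat \<Rightarrow> 'b set" where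
  "flag_meet e i = Vs_flag i \<inter> V_flag (e - i)"

lemma linear_A: "Vector_Spaces.linear (*s) (*s) A"
  and linear_As: "Vector_Spaces.linear (*s) (*s) As"
  using td_pair by (simp_all add: tridiagonal_pair_def)

lemma irreducible: "subspace W \<Longrightarrow> A ` W \<subseteq> W \<Longrightarrow> As ` W \<subseteq> W \<Longrightarrow> W = {0} \<or> W = UNIV"
  using td_pair by (simp add: tridiagonal_pair_def)

lemma subspace_V: "subspace (V j)" and subspace_Vs: "subspace (Vs j)"
  by (simp_all add: V_def Vs_def subspace_eigsp linear_A linear_As)

lemma A_V: "y \<in> V j \<Longrightarrow> A y = th j *s y" and As_Vs: "y \<in> Vs j \<Longrightarrow> As y = ths j *s y"
  by (simp_all add: V_def Vs_def eigsp_def)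

text \<open>For \<open>j = 0\<close> the truncated \<open>j - 1\<close> is \<open>0\<close>, so \<open>{j - 1..j + 1}\<close> is still the right set of
  neighbours.\<close>

lemma As_V:
  assumes "j \<le> d" "y \<in> V j"
  shows "As y \<in> span (\<Union>(V ` ({j - 1..j + 1} \<inter> {..d})))"
proof -
  have "As ` V j \<subseteq> ssum (ext d V) {int j - 1..int j + 1}"
    using standard_A assms(1) by (simp add: standard_ordering_def V_def[abs_def])
  then show ?thesis
    using assms(2) ssum_ext_adjacent[of d V j] subspace_V by auto
qed

lemma A_Vs:
  assumes "i \<le> d" "y \<in> Vs i"
  shows "A y \<in> span (\<Union>(Vs ` ({i - 1..i + 1} \<inter> {..d})))"
proof -
  have "A ` Vs i \<subseteq> ssum (ext d Vs) {int i - 1..int i + 1}"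
    using standard_As assms(1) by (simp add: standard_ordering_def Vs_def[abs_def])
  then show ?thesis
    using assms(2) ssum_ext_adjacent[of d Vs i] subspace_Vs by auto
qed

lemma V_nonzero: "j \<le> d \<Longrightarrow> V j \<noteq> {0}" and Vs_nonzero: "i \<le> d \<Longrightarrow> Vs i \<noteq> {0}"
  using standard_A standard_As by (simp_all add: standard_ordering_def V_def Vs_def)

lemma V_flag_d: "V_flag d = UNIV"
proof -
  have "eigsp (*s) A mu \<subseteq> V_flag d" for mu
  proof (cases "eigsp (*s) A mu = {0}")
    case False
    then obtain j where "j \<le> d" "mu = th j"
      using standard_A by (auto simp: standard_ordering_def)
    then show ?thesis
      by (auto simp: V_flag_def V_def intro: span_base)
  qed (simp add: V_flag_def span_zero)
  then have "span (\<Union>mu. eigsp (*s) A mu) \<subseteq> V_flag d"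
    by (intro span_minimal) (auto simp: V_flag_def)
  then show ?thesis
    using td_pair by (auto simp: tridiagonal_pair_def diagonalizable_def)
qed

lemma subspace_V_flag: "subspace (V_flag j)"
  and subspace_Vs_flag: "subspace (Vs_flag i)"
  and subspace_flag_meet: "subspace (flag_meet e i)"
  by (simp_all add: V_flag_def Vs_flag_def flag_meet_def subspace_inter)

lemma V_flag_mono: "j \<le> k \<Longrightarrow> V_flag j \<subseteq> V_flag k"
  and Vs_flag_mono: "j \<le> k \<Longrightarrow> Vs_flag j \<subseteq> Vs_flag k"
  unfolding V_flag_def Vs_flag_def by (intro span_mono UN_mono; simp)+

lemma A_shift_V_flag:
  "j \<le> d \<Longrightarrow> u \<in> V_flag j \<Longrightarrow> A u - th j *s u \<in> span (\<Union>(V ` {..<j}))"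
  unfolding V_flag_def
  by (rule lowering_lower_flag[OF linear_A])
    (simp_all add: A_V ext_def subspace_0[OF subspace_V])

lemma As_shift_Vs_flag:
  "i \<le> d \<Longrightarrow> u \<in> Vs_flag i \<Longrightarrow> As u - ths i *s u \<in> span (\<Union>(Vs ` {..<i}))"
  unfolding Vs_flag_def
  by (rule lowering_lower_flag[OF linear_As])
    (simp_all add: As_Vs ext_def subspace_0[OF subspace_Vs])

lemma A_Vs_flag:
  assumes "i \<le> d" "u \<in> Vs_flag i"
  shows "A u \<in> Vs_flag (min (Suc i) d)"
proof (rule span_image_subset[OF linear_A _ subspace_Vs_flag])
  show "u \<in> span (\<Union>(Vs ` {..i}))"
    using assms(2) by (simp add: Vs_flag_def)
  fix y assume "y \<in> \<Union>(Vs ` {..i})"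
  then obtain j where "j \<le> i" "y \<in> Vs j" by blast
  moreover have "span (\<Union>(Vs ` ({j - 1..j + 1} \<inter> {..d}))) \<subseteq> Vs_flag (min (Suc i) d)"
    using \<open>j \<le> i\<close> unfolding Vs_flag_def by (intro span_mono UN_mono) auto
  ultimately show "A y \<in> Vs_flag (min (Suc i) d)"
    using A_Vs[of j y] assms(1) by auto
qed

lemma As_V_flag:
  assumes "j \<le> d" "u \<in> V_flag j"
  shows "As u \<in> V_flag (min (Suc j) d)"
proof (rule span_image_subset[OF linear_As _ subspace_V_flag])
  show "u \<in> span (\<Union>(V ` {..j}))"
    using assms(2) by (simp add: V_flag_def)
  fix y assume "y \<in> \<Union>(V ` {..j})"
  then obtain k where "k \<le> j" "y \<in> V k" by blast
  moreover have "span (\<Union>(V ` ({k - 1..k + 1} \<inter> {..d}))) \<subseteq> V_flag (min (Suc j) d)"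
    using \<open>k \<le> j\<close> unfolding V_flag_def by (intro span_mono UN_mono) auto
  ultimately show "As y \<in> V_flag (min (Suc j) d)"
    using As_V[of k y] assms(1) by auto
qed

lemma A_flag_meet:
  assumes "e \<le> d" "i \<le> e" "u \<in> flag_meet e i"
  shows "A u - th (e - i) *s u \<in> ext e (flag_meet e) (int i + 1)"
proof -
  have "A u \<in> Vs_flag (min (Suc i) d)" "u \<in> Vs_flag (min (Suc i) d)"
    using A_Vs_flag[of i u] Vs_flag_mono[of i "min (Suc i) d"] assms by (auto simp: flag_meet_def)
  then have in_Vs_flag: "A u - th (e - i) *s u \<in> Vs_flag (min (Suc i) d)"
    by (intro subspace_diff subspace_scale subspace_Vs_flag)
  have in_V_flag: "A u - th (e - i) *s u \<in> span (\<Union>(V ` {..<e - i}))"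
    using A_shift_V_flag[of "e - i" u] assms by (simp add: flag_meet_def)
  show ?thesis
  proof (cases "i < e")
    case True
    then have "min (Suc i) d = Suc i" "{..<e - i} = {..e - Suc i}"
      using assms(1) by (auto simp flip: lessThan_Suc_atMost)
    then show ?thesis
      using True in_Vs_flag in_V_flag by (simp add: flag_meet_def V_flag_def ext_plus_one)
  next
    case False
    then show ?thesis
      using in_V_flag by (simp add: ext_def)
  qed
qed

lemma As_flag_meet:
  assumes "e \<le> d" "i \<le> e" "u \<in> flag_meet e i"
  shows "As u - ths i *s u \<in> ext e (flag_meet e) (int i - 1)"
proof -
  have "e - i \<le> d"
    using assms by simp
  then have "As u \<in> V_flag (min (Suc (e - i)) d)" "u \<in> V_flag (min (Suc (e - i)) d)"
    using As_V_flag[of "e - i" u] V_flag_mono[of "e - i" "min (Suc (e - i)) d"] assms(3)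
    by (auto simp: flag_meet_def)
  then have in_V_flag: "As u - ths i *s u \<in> V_flag (min (Suc (e - i)) d)"
    by (intro subspace_diff subspace_scale subspace_V_flag)
  have in_Vs_flag: "As u - ths i *s u \<in> span (\<Union>(Vs ` {..<i}))"
    using As_shift_Vs_flag[of i u] assms by (simp add: flag_meet_def)
  show ?thesis
  proof (cases "0 < i")
    case True
    then have "{..<i} = {..i - 1}" "min (Suc (e - i)) d = e - (i - 1)"
      using assms by auto
    then show ?thesis
      using True assms in_Vs_flag in_V_flag by (simp add: flag_meet_def Vs_flag_def ext_minus_one)
  next
    case False
    then show ?thesis
      using in_Vs_flag by (simp add: ext_def)
  qed
qed

lemma span_flag_meet_cases:
  assumes "e \<le> d"
  shows "span (\<Union>(flag_meet e ` {..e})) = {0} \<or> span (\<Union>(flag_meet e ` {..e})) = UNIV"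
proof (rule irreducible)
  let ?W = "span (\<Union>(flag_meet e ` {..e}))"
  have in_W: "ext e (flag_meet e) k \<subseteq> ?W" for k
    by (rule ext_subset_span) auto
  show "A ` ?W \<subseteq> ?W"
  proof
    fix v assume "v \<in> A ` ?W"
    then obtain u where "u \<in> ?W" "v = A u" by blast
    have "A u - 0 *s u \<in> ?W"
    proof (rule span_shift[OF linear_A _ _ \<open>u \<in> ?W\<close>, where c = "\<lambda>i. th (e - i)"])
      fix i y assume "i \<in> {..e}" "y \<in> flag_meet e i"
      then show "A y - th (e - i) *s y \<in> ?W"
        using A_flag_meet[of e i y] assms in_W[of "int i + 1"] by blast
    qed simp
    then show "v \<in> ?W"
      using \<open>v = A u\<close> by simp
  qed
  show "As ` ?W \<subseteq> ?W"
  proof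
    fix v assume "v \<in> As ` ?W"
    then obtain u where "u \<in> ?W" "v = As u" by blast
    have "As u - 0 *s u \<in> ?W"
    proof (rule span_shift[OF linear_As _ _ \<open>u \<in> ?W\<close>, where c = ths])
      fix i y assume "i \<in> {..e}" "y \<in> flag_meet e i"
      then show "As y - ths i *s y \<in> ?W"
        using As_flag_meet[of e i y] assms in_W[of "int i - 1"] by blast
    qed simp
    then show "v \<in> ?W"
      using \<open>v = As u\<close> by simp
  qed
qed simp

lemma span_flag_meet_eq_UNIV: "span (\<Union>(flag_meet d ` {..d})) = UNIV"
proof -
  obtain x where "x \<in> Vs 0" "x \<noteq> 0"
    using Vs_nonzero[of 0] subspace_0[OF subspace_Vs] by blast
  then have "x \<in> flag_meet d 0"
    by (auto simp: flag_meet_def V_flag_d Vs_flag_def intro: span_base)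
  then have "x \<in> span (\<Union>(flag_meet d ` {..d}))"
    by (auto intro: span_base)
  then show ?thesis
    using span_flag_meet_cases[of d] \<open>x \<noteq> 0\<close> by auto
qed

lemma span_flag_meet_subset_Vs_flag:
  "(\<And>j. j \<in> J \<Longrightarrow> j \<le> i) \<Longrightarrow> span (\<Union>(flag_meet e ` J)) \<subseteq> Vs_flag i"
  using Vs_flag_mono by (intro span_minimal subspace_Vs_flag) (auto simp: flag_meet_def)

lemma span_flag_meet_subset_V_flag:
  "(\<And>j. j \<in> J \<Longrightarrow> e - j \<le> k) \<Longrightarrow> span (\<Union>(flag_meet e ` J)) \<subseteq> V_flag k"
  using V_flag_mono by (intro span_minimal subspace_V_flag) (auto simp: flag_meet_def)

lemma flag_meet_pred_trivial:
  assumes "k < d"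
  shows "flag_meet (d - 1) k = {0}"
proof -
  let ?W = "span (\<Union>(flag_meet (d - 1) ` {..d - 1}))"
  obtain z where z: "z \<in> V d" "z \<noteq> 0"
    using V_nonzero[of d] subspace_0[OF subspace_V] by blast
  have "inj_on th {..d}"
    using standard_A by (simp add: standard_ordering_def)
  then have "th d \<notin> th ` {..d - 1}"
    using assms by (fastforce dest: inj_onD)
  then have "z \<notin> V_flag (d - 1)"
    using eigenvector_in_span_other_eigsp[OF linear_A, of "{..d - 1}" "th d" th z] z
    by (auto simp: V_flag_def V_def eigsp_def)
  moreover have "?W \<subseteq> V_flag (d - 1)"
    by (rule span_flag_meet_subset_V_flag) auto
  ultimately have "?W = {0}"
    using span_flag_meet_cases[of "d - 1"] by auto
  moreover have "flag_meet (d - 1) k \<subseteq> ?W"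
    using assms by (intro subsetI span_base UN_I[of k]) auto
  ultimately show ?thesis
    using subspace_0[OF subspace_flag_meet] by blast
qed

lemma Vs_flag_subset_span_flag_meet:
  assumes "k \<le> d"
  shows "Vs_flag k \<subseteq> span (\<Union>(flag_meet d ` {..k}))"
proof
  fix x assume x: "x \<in> Vs_flag k"
  have "{..d} = {..k} \<union> {k<..d}"
    using assms by auto
  then have "x \<in> span (\<Union>(flag_meet d ` {..k}) \<union> \<Union>(flag_meet d ` {k<..d}))"
    using span_flag_meet_eq_UNIV by (metis UNIV_I image_Un Union_Un_distrib)
  then obtain y w where xyw: "x = y + w" and y: "y \<in> span (\<Union>(flag_meet d ` {..k}))"
    and w: "w \<in> span (\<Union>(flag_meet d ` {k<..d}))"
    by (auto simp: span_Un)
  have "y \<in> Vs_flag k"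
    using y span_flag_meet_subset_Vs_flag[of "{..k}" k d] by auto
  then have "w \<in> Vs_flag k"
    using x xyw subspace_diff[OF subspace_Vs_flag, of x k y] by simp
  moreover have "span (\<Union>(flag_meet d ` {k<..d})) \<subseteq> V_flag (d - 1 - k)"
    by (rule span_flag_meet_subset_V_flag) auto
  then have "w \<in> V_flag (d - 1 - k)"
    using w by blast
  ultimately have "w = 0"
    using flag_meet_pred_trivial[of k] w assms
    by (cases "k < d") (auto simp: flag_meet_def)
  then show "x \<in> span (\<Union>(flag_meet d ` {..k}))"
    using xyw y by simp
qed

lemma flag_meet_adjacent:
  assumes "i \<le> d" "x \<in> Vs_flag (min (Suc i) d)" "x \<in> V_flag (min (d - i + 1) d)"
  shows "x \<in> span (\<Union>(flag_meet d ` ({i - 1..i + 1} \<inter> {..d})))"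
proof -
  have "{..min (Suc i) d} = {..<i - 1} \<union> ({i - 1..i + 1} \<inter> {..d})"
    using assms(1) by auto
  then have "x \<in> span (\<Union>(flag_meet d ` {..<i - 1}) \<union> \<Union>(flag_meet d ` ({i - 1..i + 1} \<inter> {..d})))"
    using Vs_flag_subset_span_flag_meet[of "min (Suc i) d"] assms(2) by (auto simp flip: image_Un)
  then obtain y w where xyw: "x = y + w" and y: "y \<in> span (\<Union>(flag_meet d ` {..<i - 1}))"
    and w: "w \<in> span (\<Union>(flag_meet d ` ({i - 1..i + 1} \<inter> {..d})))"
    by (auto simp: span_Un)
  have "span (\<Union>(flag_meet d ` ({i - 1..i + 1} \<inter> {..d}))) \<subseteq> V_flag (min (d - i + 1) d)"
    by (rule span_flag_meet_subset_V_flag) (use assms(1) in auto)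
  then have "w \<in> V_flag (min (d - i + 1) d)"
    using w by blast
  then have y_V: "y \<in> V_flag (min (d - i + 1) d)"
    using assms(3) xyw subspace_diff[OF subspace_V_flag, of x _ w] by simp
  have "span (\<Union>(flag_meet d ` {..<i - 1})) \<subseteq> Vs_flag (i - 2)"
    by (rule span_flag_meet_subset_Vs_flag) auto
  then have y_Vs: "y \<in> Vs_flag (i - 2)"
    using y by blast
  have "y = 0"
  proof (cases "2 \<le> i")
    case True
    then have "d - 1 - (i - 2) = min (d - i + 1) d"
      using assms(1) by auto
    then have "y \<in> flag_meet (d - 1) (i - 2)"
      using y_V y_Vs by (simp add: flag_meet_def)
    then show ?thesis
      using flag_meet_pred_trivial[of "i - 2"] True assms(1) by auto
  next
    case False
    then have "{..<i - 1} = {}"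
      by auto
    then show ?thesis
      using y by simp
  qed
  then show ?thesis
    using xyw w by simp
qed

end

section \<open>The q-geometric case\<close>

locale q_geometric_td_pair =
  standard_td_pair scale A As d
    "\<lambda>i. a * q powi (2 * int i - int d)" "\<lambda>i. as * q powi (int d - 2 * int i)"
  for scale :: "'a::field \<Rightarrow> 'b::ab_group_add \<Rightarrow> 'b" (infixr \<open>*s\<close> 75)
    and A As :: "'b \<Rightarrow> 'b" and d :: nat and q a as :: 'a +
  fixes B Bs :: "'b \<Rightarrow> 'b" and b bs :: 'a
  assumes q_nonzero: "q \<noteq> 0" and q_not_root_of_unity: "not_root_of_unity q"
    and a_nonzero: "a \<noteq> 0" and as_nonzero: "as \<noteq> 0"
    and linear_B: "Vector_Spaces.linear (*s) (*s) B"
    and linear_Bs: "Vector_Spaces.linear (*s) (*s) Bs"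
    and B_dec_0s0: "\<And>i u. i \<le> d \<Longrightarrow> u \<in> dec_0s0 d V Vs i \<Longrightarrow>
      B u = (b * q powi (2 * int i - int d)) *s u"
    and Bs_dec_DsD: "\<And>i u. i \<le> d \<Longrightarrow> u \<in> dec_DsD d V Vs i \<Longrightarrow>
      Bs u = (bs * q powi (int d - 2 * int i)) *s u"
begin

definition qpow :: "int \<Rightarrow> 'a" where "qpow k = q powi (2 * k - int d)"

lemma qpow_nonzero: "qpow k \<noteq> 0"
  using q_nonzero by (simp add: qpow_def)

lemma qpow_succ: "qpow (k + 1) = q\<^sup>2 * qpow k"
proof -
  have "qpow (k + 1) = q powi (2 * k - int d + 2)"
    by (simp add: qpow_def algebra_simps)
  also have "\<dots> = q\<^sup>2 * qpow k"
    using q_nonzero by (simp add: power_int_add qpow_def mult.commute)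
  finally show ?thesis .
qed

lemma qpow_inj: "qpow k = qpow l \<Longrightarrow> k = l"
  using power_int_inj[OF q_nonzero q_not_root_of_unity] by (force simp: qpow_def)

lemma powi_reflect: "q powi (int d - 2 * k) = inverse (qpow k)"
  by (simp add: qpow_def flip: power_int_minus)

lemma A_V_qpow: "y \<in> V j \<Longrightarrow> A y = (a * qpow (int j)) *s y"
  by (simp add: A_V qpow_def)

lemma As_Vs_qpow: "y \<in> Vs j \<Longrightarrow> As y = (as * inverse (qpow (int j))) *s y"
  by (simp add: As_Vs powi_reflect)

lemma A_eigenvector_in_ext:
  assumes "A w = (a * qpow k) *s w"
  shows "w \<in> ext d V k"
proof (cases "0 \<le> k \<and> k \<le> int d")
  case True
  then show ?thesis
    using assms by (simp add: ext_def V_def eigsp_def qpow_def)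
next
  case False
  have "eigsp (*s) A (a * qpow k) = {0}"
  proof (rule ccontr)
    assume "eigsp (*s) A (a * qpow k) \<noteq> {0}"
    then obtain j where "j \<le> d" "a * qpow k = a * q powi (2 * int j - int d)"
      using standard_A unfolding standard_ordering_def by blast
    then show False
      using False a_nonzero qpow_inj[of k "int j"] by (auto simp: qpow_def)
  qed
  moreover have "w \<in> eigsp (*s) A (a * qpow k)"
    using assms by (simp add: eigsp_def)
  ultimately show ?thesis
    using False by (simp add: ext_out_of_range)
qed

lemma As_eigenvector_in_ext:
  assumes "As w = (as * inverse (qpow k)) *s w"
  shows "w \<in> ext d Vs k"
proof (cases "0 \<le> k \<and> k \<le> int d")
  case True
  then have "ext d Vs k = eigsp (*s) As (as * inverse (qpow k))"
    unfolding ext_in_range[OF True] Vs_def by (simp add: powi_reflect)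
  then show ?thesis
    using assms by (simp add: eigsp_def)
next
  case False
  have "eigsp (*s) As (as * inverse (qpow k)) = {0}"
  proof (rule ccontr)
    assume "eigsp (*s) As (as * inverse (qpow k)) \<noteq> {0}"
    then obtain j where "j \<le> d" "as * inverse (qpow k) = as * q powi (int d - 2 * int j)"
      using standard_As unfolding standard_ordering_def by blast
    then show False
      using False as_nonzero qpow_inj[of k "int j"] by (auto simp: powi_reflect)
  qed
  moreover have "w \<in> eigsp (*s) As (as * inverse (qpow k))"
    using assms by (simp add: eigsp_def)
  ultimately show ?thesis
    using False by (simp add: ext_out_of_range)
qed

text \<open>Reversing both standard orderings turns \<open>flag_meet d\<close> into the split decomposition [D*D].\<close>

sublocale rev: standard_td_pair scale A As d
  "\<lambda>i. a * q powi (2 * int (d - i) - int d)" "\<lambda>i. as * q powi (int d - 2 * int (d - i))"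
  using td_pair standard_ordering_reverse[OF standard_A] standard_ordering_reverse[OF standard_As]
  by unfold_locales

lemma rev_V: "rev.V = (\<lambda>j. V (d - j))" and rev_Vs: "rev.Vs = (\<lambda>j. Vs (d - j))"
  by (simp_all add: fun_eq_iff rev.V_def V_def rev.Vs_def Vs_def)

lemma rev_V_flag: "rev.V_flag k = span (\<Union>(V ` {d - k..d}))"
  and rev_Vs_flag: "rev.Vs_flag k = span (\<Union>(Vs ` {d - k..d}))" if "k \<le> d"
  unfolding rev.V_flag_def rev.Vs_flag_def rev_V rev_Vs image_diff_atMost[OF that, symmetric]
  by (simp_all add: image_image)

lemma ssum_V: "finite I \<Longrightarrow> ssum V I = span (\<Union>(V ` I))"
  and ssum_Vs: "finite I \<Longrightarrow> ssum Vs I = span (\<Union>(Vs ` I))"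
  by (simp_all add: ssum_eq_span subspace_V subspace_Vs)

lemma dec_0s0_eq: "dec_0s0 d V Vs = flag_meet d"
  by (simp add: fun_eq_iff dec_0s0_def flag_meet_def ssum_V ssum_Vs V_flag_def Vs_flag_def
      atLeast0AtMost)

lemma dec_DsD_eq: "i \<le> d \<Longrightarrow> dec_DsD d V Vs i = rev.flag_meet d i"
  by (simp add: dec_DsD_def rev.flag_meet_def ssum_V ssum_Vs rev_V_flag rev_Vs_flag)

lemma B_on_flag_meet:
  assumes "u \<in> ext d (flag_meet d) k"
  shows "B u = (b * qpow k) *s u"
proof (cases "0 \<le> k \<and> k \<le> int d")
  case True
  then have "nat k \<le> d" "u \<in> dec_0s0 d V Vs (nat k)"
    using assms by (auto simp: ext_def dec_0s0_eq)
  then have "B u = (b * q powi (2 * int (nat k) - int d)) *s u"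
    by (rule B_dec_0s0)
  then show ?thesis
    using True by (simp add: qpow_def)
next
  case False
  then show ?thesis
    using assms endo.linear_0[OF linear_B] by (simp add: ext_out_of_range)
qed

lemma Bs_on_rev_flag_meet:
  assumes "u \<in> ext d (rev.flag_meet d) k"
  shows "Bs u = (bs * inverse (qpow k)) *s u"
proof (cases "0 \<le> k \<and> k \<le> int d")
  case True
  then have "nat k \<le> d" "u \<in> dec_DsD d V Vs (nat k)"
    using assms by (auto simp: ext_def dec_DsD_eq)
  then have "Bs u = (bs * q powi (int d - 2 * int (nat k))) *s u"
    by (rule Bs_dec_DsD)
  then show ?thesis
    using True by (simp add: powi_reflect)
next
  case False
  then show ?thesis
    using assms endo.linear_0[OF linear_Bs] by (simp add: ext_out_of_range)
qed

lemma q_weyl_A_B: "q_weyl_rel (*s) q A B (a * b)"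
proof (rule q_weyl_relI[OF linear_A linear_B q_nonzero span_flag_meet_eq_UNIV,
      where \<beta> = "\<lambda>i. b * qpow (int i)" and \<alpha> = "\<lambda>i. a * inverse (qpow (int i))"])
  fix i u assume "i \<in> {..d}" "u \<in> flag_meet d i"
  then show "B u = (b * qpow (int i)) *s u"
    using B_on_flag_meet[of u "int i"] by (simp add: ext_in_range)
  have r: "A u - (a * inverse (qpow (int i))) *s u \<in> ext d (flag_meet d) (int i + 1)"
    using A_flag_meet[of d i u] \<open>i \<in> {..d}\<close> \<open>u \<in> flag_meet d i\<close> by (simp add: powi_reflect)
  show "B (A u - (a * inverse (qpow (int i))) *s u)
      = (q\<^sup>2 * (b * qpow (int i))) *s (A u - (a * inverse (qpow (int i))) *s u)"
    using B_on_flag_meet[OF r] by (simp add: qpow_succ mult_ac)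
qed (simp add: qpow_nonzero)

lemma q_weyl_As_B: "q_weyl_rel (*s) (inverse q) As B (as * b)"
proof (rule q_weyl_relI[OF linear_As linear_B _ span_flag_meet_eq_UNIV,
      where \<beta> = "\<lambda>i. b * qpow (int i)" and \<alpha> = "\<lambda>i. as * inverse (qpow (int i))"])
  fix i u assume "i \<in> {..d}" "u \<in> flag_meet d i"
  then show "B u = (b * qpow (int i)) *s u"
    using B_on_flag_meet[of u "int i"] by (simp add: ext_in_range)
  have "As u - (as * inverse (qpow (int i))) *s u \<in> ext d (flag_meet d) (int i - 1)"
    using As_flag_meet[of d i u] \<open>i \<in> {..d}\<close> \<open>u \<in> flag_meet d i\<close> by (simp add: powi_reflect)
  moreover have "qpow (int i - 1) = (inverse q)\<^sup>2 * qpow (int i)"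
    using qpow_succ[of "int i - 1"] q_nonzero by (simp add: field_simps)
  ultimately show "B (As u - (as * inverse (qpow (int i))) *s u)
      = ((inverse q)\<^sup>2 * (b * qpow (int i))) *s (As u - (as * inverse (qpow (int i))) *s u)"
    using B_on_flag_meet by (simp add: mult_ac)
qed (simp_all add: qpow_nonzero q_nonzero)

lemma q_weyl_A_Bs: "q_weyl_rel (*s) (inverse q) A Bs (a * bs)"
proof (rule q_weyl_relI[OF linear_A linear_Bs _ rev.span_flag_meet_eq_UNIV,
      where \<beta> = "\<lambda>i. bs * inverse (qpow (int i))" and \<alpha> = "\<lambda>i. a * qpow (int i)"])
  fix i u assume "i \<in> {..d}" "u \<in> rev.flag_meet d i"
  then show "Bs u = (bs * inverse (qpow (int i))) *s u"
    using Bs_on_rev_flag_meet[of u "int i"] by (simp add: ext_in_range)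
  have "A u - (a * qpow (int i)) *s u \<in> ext d (rev.flag_meet d) (int i + 1)"
    using rev.A_flag_meet[of d i u] \<open>i \<in> {..d}\<close> \<open>u \<in> rev.flag_meet d i\<close>
    by (simp add: qpow_def of_nat_diff)
  moreover have "inverse (qpow (int i + 1)) = (inverse q)\<^sup>2 * inverse (qpow (int i))"
    by (simp add: qpow_succ power_inverse)
  ultimately show "Bs (A u - (a * qpow (int i)) *s u)
      = ((inverse q)\<^sup>2 * (bs * inverse (qpow (int i)))) *s (A u - (a * qpow (int i)) *s u)"
    using Bs_on_rev_flag_meet by (simp add: mult_ac)
qed (simp_all add: qpow_nonzero q_nonzero)

lemma q_weyl_As_Bs: "q_weyl_rel (*s) q As Bs (as * bs)"
proof (rule q_weyl_relI[OF linear_As linear_Bs q_nonzero rev.span_flag_meet_eq_UNIV,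
      where \<beta> = "\<lambda>i. bs * inverse (qpow (int i))" and \<alpha> = "\<lambda>i. as * qpow (int i)"])
  fix i u assume "i \<in> {..d}" "u \<in> rev.flag_meet d i"
  then show "Bs u = (bs * inverse (qpow (int i))) *s u"
    using Bs_on_rev_flag_meet[of u "int i"] by (simp add: ext_in_range)
  have "As u - (as * qpow (int i)) *s u \<in> ext d (rev.flag_meet d) (int i - 1)"
    using rev.As_flag_meet[of d i u] \<open>i \<in> {..d}\<close> \<open>u \<in> rev.flag_meet d i\<close>
    by (simp add: qpow_def)
  moreover have "inverse (qpow (int i - 1)) = q\<^sup>2 * inverse (qpow (int i))"
    using qpow_succ[of "int i - 1"] q_nonzero by (simp add: field_simps)
  ultimately show "Bs (As u - (as * qpow (int i)) *s u)
      = (q\<^sup>2 * (bs * inverse (qpow (int i)))) *s (As u - (as * qpow (int i)) *s u)"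
    using Bs_on_rev_flag_meet by (simp add: mult_ac)
qed (simp add: qpow_nonzero)

lemma B_V:
  assumes "y \<in> V j"
  shows "B y - (b * q powi (int d - 2 * int j)) *s y \<in> ext d V (int j - 1)"
proof -
  have "q_weyl_rel (*s) q A B ((a * qpow (int j)) * (b * inverse (qpow (int j))))"
    using q_weyl_A_B qpow_nonzero[of "int j"] by (simp add: field_simps)
  then have "A (B y - (b * inverse (qpow (int j))) *s y)
      = (a * qpow (int j) / q\<^sup>2) *s (B y - (b * inverse (qpow (int j))) *s y)"
    by (rule q_weyl_rel_eigenvector[OF linear_A linear_B q_nonzero _ A_V_qpow[OF assms]])
  also have "a * qpow (int j) / q\<^sup>2 = a * qpow (int j - 1)"
    using qpow_succ[of "int j - 1"] q_nonzero by simp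
  finally show ?thesis
    by (simp add: powi_reflect A_eigenvector_in_ext)
qed

lemma Bs_V:
  assumes "y \<in> V j"
  shows "Bs y - (bs * q powi (int d - 2 * int j)) *s y \<in> ext d V (int j + 1)"
proof -
  have "q_weyl_rel (*s) (inverse q) A Bs ((a * qpow (int j)) * (bs * inverse (qpow (int j))))"
    using q_weyl_A_Bs qpow_nonzero[of "int j"] by (simp add: field_simps)
  then have "A (Bs y - (bs * inverse (qpow (int j))) *s y)
      = (a * qpow (int j) / (inverse q)\<^sup>2) *s (Bs y - (bs * inverse (qpow (int j))) *s y)"
    using q_nonzero
    by (intro q_weyl_rel_eigenvector[OF linear_A linear_Bs _ _ A_V_qpow[OF assms]]) simp_all
  also have "a * qpow (int j) / (inverse q)\<^sup>2 = a * qpow (int j + 1)"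
    by (simp add: qpow_succ power_inverse divide_inverse mult_ac)
  finally show ?thesis
    by (simp add: powi_reflect A_eigenvector_in_ext)
qed

lemma B_Vs:
  assumes "y \<in> Vs j"
  shows "B y - (b * q powi (2 * int j - int d)) *s y \<in> ext d Vs (int j - 1)"
proof -
  have "q_weyl_rel (*s) (inverse q) As B ((as * inverse (qpow (int j))) * (b * qpow (int j)))"
    using q_weyl_As_B qpow_nonzero[of "int j"] by (simp add: field_simps)
  then have "As (B y - (b * qpow (int j)) *s y)
      = (as * inverse (qpow (int j)) / (inverse q)\<^sup>2) *s (B y - (b * qpow (int j)) *s y)"
    using q_nonzero
    by (intro q_weyl_rel_eigenvector[OF linear_As linear_B _ _ As_Vs_qpow[OF assms]]) simp_all
  also have "as * inverse (qpow (int j)) / (inverse q)\<^sup>2 = as * inverse (qpow (int j - 1))"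
    using qpow_succ[of "int j - 1"] q_nonzero by (simp add: power_inverse field_simps)
  finally show ?thesis
    by (simp add: qpow_def[symmetric] As_eigenvector_in_ext)
qed

lemma Bs_Vs:
  assumes "y \<in> Vs j"
  shows "Bs y - (bs * q powi (2 * int j - int d)) *s y \<in> ext d Vs (int j + 1)"
proof -
  have "q_weyl_rel (*s) q As Bs ((as * inverse (qpow (int j))) * (bs * qpow (int j)))"
    using q_weyl_As_Bs qpow_nonzero[of "int j"] by (simp add: field_simps)
  then have "As (Bs y - (bs * qpow (int j)) *s y)
      = (as * inverse (qpow (int j)) / q\<^sup>2) *s (Bs y - (bs * qpow (int j)) *s y)"
    by (rule q_weyl_rel_eigenvector[OF linear_As linear_Bs q_nonzero _ As_Vs_qpow[OF assms]])
  also have "as * inverse (qpow (int j)) / q\<^sup>2 = as * inverse (qpow (int j + 1))"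
    unfolding qpow_succ by (simp add: divide_inverse mult_ac)
  finally show ?thesis
    by (simp add: qpow_def[symmetric] As_eigenvector_in_ext)
qed

lemma dec_0D:
  "shifted_image (*s) B (b * q powi (int d - 2 * int i)) (dec_0D d V Vs i)
     \<subseteq> ext d (dec_0D d V Vs) (int i - 1)"
  "shifted_image (*s) Bs (bs * q powi (int d - 2 * int i)) (dec_0D d V Vs i)
     \<subseteq> ext d (dec_0D d V Vs) (int i + 1)"
  using B_V Bs_V by (auto simp: shifted_image_def dec_0D_def[abs_def])

lemma dec_0sDs:
  "shifted_image (*s) B (b * q powi (2 * int i - int d)) (dec_0sDs d V Vs i)
     \<subseteq> ext d (dec_0sDs d V Vs) (int i - 1)"
  "shifted_image (*s) Bs (bs * q powi (2 * int i - int d)) (dec_0sDs d V Vs i)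
     \<subseteq> ext d (dec_0sDs d V Vs) (int i + 1)"
  using B_Vs Bs_Vs by (auto simp: shifted_image_def dec_0sDs_def[abs_def])

lemma dec_0sD_eq: "dec_0sD d V Vs i = Vs_flag i \<inter> span (\<Union>(V ` {i..d}))"
  by (simp add: dec_0sD_def ssum_V ssum_Vs Vs_flag_def atLeast0AtMost)

lemma dec_0sD:
  assumes "i \<le> d"
  shows "shifted_image (*s) B (b * q powi (2 * int i - int d)) (dec_0sD d V Vs i)
      \<subseteq> ext d (dec_0sD d V Vs) (int i - 1)"
    and "shifted_image (*s) Bs (bs * q powi (int d - 2 * int i)) (dec_0sD d V Vs i)
      \<subseteq> ext d (dec_0sD d V Vs) (int i + 1)"
proof -
  have flags: "u \<in> span (\<Union>(Vs ` {..i}))" "u \<in> span (\<Union>(V ` {i..d}))"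
    if "u \<in> dec_0sD d V Vs i" for u
    using that by (simp_all add: dec_0sD_eq Vs_flag_def)
  show "shifted_image (*s) B (b * q powi (2 * int i - int d)) (dec_0sD d V Vs i)
      \<subseteq> ext d (dec_0sD d V Vs) (int i - 1)"
  proof (unfold shifted_image_def, rule image_subsetI)
    fix u assume "u \<in> dec_0sD d V Vs i"
    let ?Bu = "B u - (b * q powi (2 * int i - int d)) *s u"
    have "?Bu \<in> span (\<Union>(Vs ` {..<i}))"
      by (rule lowering_lower_flag[where c = "\<lambda>j. b * q powi (2 * int j - int d)",
            OF linear_B _ assms flags(1)[OF \<open>u \<in> _\<close>]])
        (simp add: B_Vs)
    moreover have "?Bu \<in> span (\<Union>(V ` {i - 1..d}))"
      by (rule lowering_upper_flag[where c = "\<lambda>j. b * q powi (int d - 2 * int j)",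
            OF linear_B _ flags(2)[OF \<open>u \<in> _\<close>]])
        (simp add: B_V)
    ultimately show "?Bu \<in> ext d (dec_0sD d V Vs) (int i - 1)"
      by (cases "i = 0")
        (auto simp: ext_out_of_range ext_minus_one dec_0sD_eq Vs_flag_def
          simp flip: lessThan_Suc_atMost)
  qed
  show "shifted_image (*s) Bs (bs * q powi (int d - 2 * int i)) (dec_0sD d V Vs i)
      \<subseteq> ext d (dec_0sD d V Vs) (int i + 1)"
  proof (unfold shifted_image_def, rule image_subsetI)
    fix u assume "u \<in> dec_0sD d V Vs i"
    let ?Bsu = "Bs u - (bs * q powi (int d - 2 * int i)) *s u"
    have "?Bsu \<in> span (\<Union>(Vs ` {..min (Suc i) d}))"
      by (rule raising_lower_flag[where c = "\<lambda>j. bs * q powi (2 * int j - int d)",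
            OF linear_Bs _ assms flags(1)[OF \<open>u \<in> _\<close>]])
        (simp add: Bs_Vs)
    moreover have "?Bsu \<in> span (\<Union>(V ` {Suc i..d}))"
      by (rule raising_upper_flag[where c = "\<lambda>j. bs * q powi (int d - 2 * int j)",
            OF linear_Bs _ flags(2)[OF \<open>u \<in> _\<close>]])
        (simp add: Bs_V)
    ultimately show "?Bsu \<in> ext d (dec_0sD d V Vs) (int i + 1)"
      using assms by (cases "i = d") (auto simp: ext_plus_one dec_0sD_eq Vs_flag_def)
  qed
qed

lemma dec_Ds0_eq: "dec_Ds0 d V Vs i = span (\<Union>(Vs ` {d - i..d})) \<inter> V_flag (d - i)"
  by (simp add: dec_Ds0_def ssum_V ssum_Vs V_flag_def atLeast0AtMost)

lemma dec_Ds0: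
  assumes "i \<le> d"
  shows "shifted_image (*s) B (b * q powi (2 * int i - int d)) (dec_Ds0 d V Vs i)
      \<subseteq> ext d (dec_Ds0 d V Vs) (int i + 1)"
    and "shifted_image (*s) Bs (bs * q powi (int d - 2 * int i)) (dec_Ds0 d V Vs i)
      \<subseteq> ext d (dec_Ds0 d V Vs) (int i - 1)"
proof -
  have flags: "u \<in> span (\<Union>(Vs ` {d - i..d}))" "u \<in> span (\<Union>(V ` {..d - i}))"
    if "u \<in> dec_Ds0 d V Vs i" for u
    using that by (simp_all add: dec_Ds0_eq V_flag_def)
  have reflect: "int d - 2 * int (d - i) = 2 * int i - int d"
    "2 * int (d - i) - int d = int d - 2 * int i"
    using assms by simp_all
  show "shifted_image (*s) B (b * q powi (2 * int i - int d)) (dec_Ds0 d V Vs i)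
      \<subseteq> ext d (dec_Ds0 d V Vs) (int i + 1)"
  proof (unfold shifted_image_def, rule image_subsetI)
    fix u assume "u \<in> dec_Ds0 d V Vs i"
    let ?Bu = "B u - (b * q powi (2 * int i - int d)) *s u"
    have "?Bu \<in> span (\<Union>(Vs ` {d - i - 1..d}))"
      by (rule lowering_upper_flag[where c = "\<lambda>j. b * q powi (2 * int j - int d)",
            OF linear_B _ flags(1)[OF \<open>u \<in> _\<close>]])
        (simp add: B_Vs)
    moreover have "B u - (b * q powi (int d - 2 * int (d - i))) *s u \<in> span (\<Union>(V ` {..<d - i}))"
      by (rule lowering_lower_flag[where c = "\<lambda>j. b * q powi (int d - 2 * int j)" and d = d,
            OF linear_B _ _ flags(2)[OF \<open>u \<in> _\<close>]])
        (simp_all add: B_V)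
    then have "?Bu \<in> span (\<Union>(V ` {..<d - i}))"
      by (simp only: reflect)
    ultimately show "?Bu \<in> ext d (dec_Ds0 d V Vs) (int i + 1)"
      using assms by (cases "i = d")
        (auto simp: ext_plus_one dec_Ds0_eq V_flag_def lessThan_Suc_atMost[symmetric] Suc_diff_Suc)
  qed
  show "shifted_image (*s) Bs (bs * q powi (int d - 2 * int i)) (dec_Ds0 d V Vs i)
      \<subseteq> ext d (dec_Ds0 d V Vs) (int i - 1)"
  proof (unfold shifted_image_def, rule image_subsetI)
    fix u assume "u \<in> dec_Ds0 d V Vs i"
    let ?Bsu = "Bs u - (bs * q powi (int d - 2 * int i)) *s u"
    have "Bs u - (bs * q powi (2 * int (d - i) - int d)) *s u \<in> span (\<Union>(Vs ` {Suc (d - i)..d}))"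
      by (rule raising_upper_flag[where c = "\<lambda>j. bs * q powi (2 * int j - int d)",
            OF linear_Bs _ flags(1)[OF \<open>u \<in> _\<close>]])
        (simp add: Bs_Vs)
    then have "?Bsu \<in> span (\<Union>(Vs ` {Suc (d - i)..d}))"
      by (simp only: reflect)
    moreover have "?Bsu \<in> span (\<Union>(V ` {..min (Suc (d - i)) d}))"
      by (rule raising_lower_flag[where c = "\<lambda>j. bs * q powi (int d - 2 * int j)",
            OF linear_Bs _ _ flags(2)[OF \<open>u \<in> _\<close>]])
        (simp_all add: Bs_V)
    ultimately show "?Bsu \<in> ext d (dec_Ds0 d V Vs) (int i - 1)"
      using assms by (cases "i = 0")
        (auto simp: ext_out_of_range ext_minus_one dec_Ds0_eq V_flag_def Suc_diff_le)
  qed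
qed

lemma dec_0s0:
  assumes "i \<le> d"
  shows "shifted_image (*s) B (b * q powi (2 * int i - int d)) (dec_0s0 d V Vs i) = {0}"
    and "Bs ` dec_0s0 d V Vs i \<subseteq> ssum (ext d (dec_0s0 d V Vs)) {int i - 1..int i + 1}"
proof -
  show "shifted_image (*s) B (b * q powi (2 * int i - int d)) (dec_0s0 d V Vs i) = {0}"
    using B_dec_0s0[OF assms] subspace_0[OF subspace_flag_meet]
    by (force simp: shifted_image_def dec_0s0_eq)
  have "Bs u \<in> span (\<Union>(flag_meet d ` ({i - 1..i + 1} \<inter> {..d})))" if "u \<in> flag_meet d i" for u
  proof (rule flag_meet_adjacent[OF assms])
    have "Bs u - 0 *s u \<in> span (\<Union>(Vs ` {..min (Suc i) d}))"
      by (rule raising_lower_flag[where c = "\<lambda>j. bs * q powi (2 * int j - int d)",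
            OF linear_Bs _ assms])
        (use that in \<open>simp_all add: Bs_Vs flag_meet_def Vs_flag_def\<close>)
    then show "Bs u \<in> Vs_flag (min (Suc i) d)"
      by (simp add: Vs_flag_def)
    have "Bs u - 0 *s u \<in> span (\<Union>(V ` {..min (Suc (d - i)) d}))"
      by (rule raising_lower_flag[where c = "\<lambda>j. bs * q powi (int d - 2 * int j)"
            and d = d and i = "d - i", OF linear_Bs])
        (use that in \<open>simp_all add: Bs_V flag_meet_def V_flag_def\<close>)
    then show "Bs u \<in> V_flag (min (d - i + 1) d)"
      by (simp add: V_flag_def)
  qed
  then show "Bs ` dec_0s0 d V Vs i \<subseteq> ssum (ext d (dec_0s0 d V Vs)) {int i - 1..int i + 1}"
    by (auto simp: dec_0s0_eq ssum_ext_adjacent subspace_flag_meet)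
qed

lemma dec_DsD:
  assumes "i \<le> d"
  shows "B ` dec_DsD d V Vs i \<subseteq> ssum (ext d (dec_DsD d V Vs)) {int i - 1..int i + 1}"
    and "shifted_image (*s) Bs (bs * q powi (int d - 2 * int i)) (dec_DsD d V Vs i) = {0}"
proof -
  have "B u \<in> span (\<Union>(rev.flag_meet d ` ({i - 1..i + 1} \<inter> {..d})))"
    if "u \<in> rev.flag_meet d i" for u
  proof (rule rev.flag_meet_adjacent[OF assms])
    have "u \<in> span (\<Union>(Vs ` {d - i..d}))"
      using that assms by (simp add: rev.flag_meet_def rev_Vs_flag)
    then have "B u - 0 *s u \<in> span (\<Union>(Vs ` {d - i - 1..d}))"
      by (rule lowering_upper_flag[where c = "\<lambda>j. b * q powi (2 * int j - int d)",
            OF linear_B, rotated])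
        (simp add: B_Vs)
    moreover have "d - min (Suc i) d = d - i - 1"
      using assms by auto
    ultimately show "B u \<in> rev.Vs_flag (min (Suc i) d)"
      by (simp add: rev_Vs_flag)
    have "u \<in> span (\<Union>(V ` {i..d}))"
      using that assms by (simp add: rev.flag_meet_def rev_V_flag)
    then have "B u - 0 *s u \<in> span (\<Union>(V ` {i - 1..d}))"
      by (rule lowering_upper_flag[where c = "\<lambda>j. b * q powi (int d - 2 * int j)",
            OF linear_B, rotated])
        (simp add: B_V)
    moreover have "d - min (d - i + 1) d = i - 1"
      using assms by auto
    ultimately show "B u \<in> rev.V_flag (min (d - i + 1) d)"
      by (simp add: rev_V_flag)
  qed
  moreover have "ext d (dec_DsD d V Vs) = ext d (rev.flag_meet d)"
    by (rule ext_cong) (simp add: dec_DsD_eq)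
  ultimately show "B ` dec_DsD d V Vs i \<subseteq> ssum (ext d (dec_DsD d V Vs)) {int i - 1..int i + 1}"
    using assms by (auto simp: dec_DsD_eq ssum_ext_adjacent rev.subspace_flag_meet)
  show "shifted_image (*s) Bs (bs * q powi (int d - 2 * int i)) (dec_DsD d V Vs i) = {0}"
    using Bs_dec_DsD[OF assms] subspace_0[OF rev.subspace_flag_meet]
    by (force simp: shifted_image_def dec_DsD_eq[OF assms])
qed

end

theorem theorem8p1:
  fixes scale :: "'k::field \<Rightarrow> 'v::ab_group_add \<Rightarrow> 'v"
    and A As B Bs :: "'v \<Rightarrow> 'v"
    and q a as b bs :: 'k
    and d :: nat
  assumes K: "alg_closed TYPE('k)"
    and q: "q \<noteq> 0" "not_root_of_unity q"
    and vs: "vector_space scale"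
    and fin: "\<exists>S. finite S \<and> module.span scale S = UNIV"
    and nz: "\<exists>v::'v. v \<noteq> 0"
    and TD: "tridiagonal_pair scale A As"
    and nzs: "a \<noteq> 0" "as \<noteq> 0" "b \<noteq> 0" "bs \<noteq> 0"
    and ordA: "standard_ordering scale A As d (\<lambda>i. a * q powi (2 * int i - int d))"
    and ordAs: "standard_ordering scale As A d (\<lambda>i. as * q powi (int d - 2 * int i))"
    and V_def: "V = (\<lambda>i. eigsp scale A (a * q powi (2 * int i - int d)))"
    and Vs_def: "Vs = (\<lambda>i. eigsp scale As (as * q powi (int d - 2 * int i)))"
    and B_lin: "Vector_Spaces.linear scale scale B"
    and B_act: "\<And>i u. i \<le> d \<Longrightarrow> u \<in> dec_0s0 d V Vs i \<Longrightarrow> B u = scale (b * q powi (2 * int i - int d)) u"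
    and Bs_lin: "Vector_Spaces.linear scale scale Bs"
    and Bs_act: "\<And>i u. i \<le> d \<Longrightarrow> u \<in> dec_DsD d V Vs i \<Longrightarrow> Bs u = scale (bs * q powi (int d - 2 * int i)) u"
  shows "\<forall>i\<le>d.
    (let U = dec_0D d V Vs in
       shifted_image scale B (b * q powi (int d - 2 * int i)) (U i) \<subseteq> ext d U (int i - 1) \<and>
       shifted_image scale Bs (bs * q powi (int d - 2 * int i)) (U i) \<subseteq> ext d U (int i + 1)) \<and>
    (let U = dec_0sDs d V Vs in
       shifted_image scale B (b * q powi (2 * int i - int d)) (U i) \<subseteq> ext d U (int i - 1) \<and>
       shifted_image scale Bs (bs * q powi (2 * int i - int d)) (U i) \<subseteq> ext d U (int i + 1)) \<and>
    (let U = dec_0sD d V Vs in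
       shifted_image scale B (b * q powi (2 * int i - int d)) (U i) \<subseteq> ext d U (int i - 1) \<and>
       shifted_image scale Bs (bs * q powi (int d - 2 * int i)) (U i) \<subseteq> ext d U (int i + 1)) \<and>
    (let U = dec_0s0 d V Vs in
       shifted_image scale B (b * q powi (2 * int i - int d)) (U i) = {0} \<and>
       Bs ` (U i) \<subseteq> ssum (ext d U) {int i - 1 .. int i + 1}) \<and>
    (let U = dec_Ds0 d V Vs in
       shifted_image scale B (b * q powi (2 * int i - int d)) (U i) \<subseteq> ext d U (int i + 1) \<and>
       shifted_image scale Bs (bs * q powi (int d - 2 * int i)) (U i) \<subseteq> ext d U (int i - 1)) \<and>
    (let U = dec_DsD d V Vs in
       B ` (U i) \<subseteq> ssum (ext d U) {int i - 1 .. int i + 1} \<and>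
       shifted_image scale Bs (bs * q powi (int d - 2 * int i)) (U i) = {0})"
proof -
  have std: "standard_td_pair scale A As d
      (\<lambda>i. a * q powi (2 * int i - int d)) (\<lambda>i. as * q powi (int d - 2 * int i))"
    by (intro standard_td_pair.intro standard_td_pair_axioms.intro vs TD ordA ordAs)
  interpret T: standard_td_pair scale A As d
      "\<lambda>i. a * q powi (2 * int i - int d)" "\<lambda>i. as * q powi (int d - 2 * int i)"
    by (rule std)
  have V_eq: "T.V = V" and Vs_eq: "T.Vs = Vs"
    by (simp_all add: fun_eq_iff T.V_def T.Vs_def V_def Vs_def)
  interpret Q: q_geometric_td_pair scale A As d q a as B Bs b bs
    using q nzs B_lin Bs_lin B_act Bs_act
    by (intro q_geometric_td_pair.intro[OF std] q_geometric_td_pair_axioms.intro)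
      (simp_all add: V_eq Vs_eq)
  show ?thesis
    unfolding Let_def V_eq[symmetric] Vs_eq[symmetric]
    using Q.dec_0D Q.dec_0sDs Q.dec_0sD Q.dec_0s0 Q.dec_Ds0 Q.dec_DsD by simp
qed

end
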